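(* Fix $t>0$, $\mu\in\mathbb{R}$ and $\sigma>0$. For $x_0\in\mathbb{R}$ let $\gamma_{x_0}$ denote the Gaussian probability measure on $\mathbb{R}$ with mean $x_0+\mu t$ and variance $\sigma^2 t$. For $n\ge1$ define $T^{**}_n:\mathbb{R}^n\to\mathbb{R}$ by $$T^{**}_n(z_1,\dots,z_n)=\frac{\sum_{k=1}^n (z_k-t\mu)}{n}.$$ Then for every $x_0\in\mathbb{R}$, $$\gamma_{x_0}^{\infty}\Big(\Big\{(z_k)_{k\in\mathbb{N}}\in\mathbb{R}^{\infty}:\ \lim_{n\to\infty}T^{**}_n(z_1,\dots,z_n)=x_0\Big\}\Big)=1,$$ that is, $(T^{**}_n)_{n\ge1}$ is a consistent estimator (in the sense of everywhere convergence) of the initial position $x_0$ for the family $(\gamma_{x_0}^\infty)_{x_0\in\mathbb{R}}$.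
   Context: $\mathbb{N}=\{1,2,\dots\}$, and $\mathbb{R}^{\infty}=\mathbb{R}^{\mathbb{N}}$ is the space of real sequences with its Borel (product) $\sigma$-algebra. For a Borel probability measure $\gamma$ on $\mathbb{R}$, $\gamma^{\infty}$ is the infinite product measure on $\mathbb{R}^{\infty}$. The measure $\gamma_{x_0}$ is the law at time $t$ of the Wiener process with drift $X_t=x_0+\mu t+\sigma W_t$. Given a family $(\gamma_\theta)_{\theta\in\mathbb{R}}$ of Borel probability measures on $\mathbb{R}$, a sequence of Borel measurable functions $T_n:\mathbb{R}^n\to\mathbb{R}$ is called a consistent estimator of $\theta$ (in the sense of everywhere convergence) for $(\gamma_\theta^\infty)_{\theta\in\mathbb{R}}$ if $\gamma_\theta^\infty(\{(x_k)_{k\in\mathbb{N}}:\lim_{n\to\infty}T_n(x_1,\dots,x_n)=\theta\})=1$ for each $\theta\in\mathbb{R}$. *)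

theory Defs
  imports "HOL-Probability.Probability"
begin

text \<open>The library's \<^const>\<open>normal_density\<close> takes the standard deviation, not the variance.\<close>

definition gaussian_measure :: "real \<Rightarrow> real \<Rightarrow> real measure" where
  "gaussian_measure m v = density lborel (\<lambda>x. ennreal (normal_density m (sqrt v) x))"

text \<open>
  Sequences are indexed by the positive integers: a point of the sequence space is a function on
  \<open>{1..}\<close> (extensional, as usual for \<^const>\<open>PiM\<close>), and a point of \<open>n\<close>-dimensional space is a
  function on \<open>{1..n}\<close>.
\<close>

definition infinite_power :: "real measure \<Rightarrow> (nat \<Rightarrow> real) measure" where
  "infinite_power M = PiM {1..} (\<lambda>_. M)"

text \<open>
  The first conjunct is the standing assumption that the family consists of Borel probability
  measures. Since \<^const>\<open>emeasure\<close> vanishes on non-measurable sets, the last conjunct also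
  asserts that the convergence event is measurable. The function \<open>T 0\<close> plays no role.
\<close>

definition consistent_estimator ::
    "(real \<Rightarrow> real measure) \<Rightarrow> (nat \<Rightarrow> (nat \<Rightarrow> real) \<Rightarrow> real) \<Rightarrow> bool" where
  "consistent_estimator \<gamma> T \<longleftrightarrow>
     (\<forall>\<theta>. prob_space (\<gamma> \<theta>) \<and> sets (\<gamma> \<theta>) = sets borel) \<and>
     (\<forall>n\<ge>1. T n \<in> borel_measurable (PiM {1..n} (\<lambda>_. borel))) \<and>
     (\<forall>\<theta>. emeasure (infinite_power (\<gamma> \<theta>))
        {x \<in> space (infinite_power (\<gamma> \<theta>)).
           (\<lambda>n. T n (restrict x {1..n})) \<longlonglongrightarrow> \<theta>} = 1)"

definition drift_mean_estimator :: "real \<Rightarrow> real \<Rightarrow> nat \<Rightarrow> (nat \<Rightarrow> real) \<Rightarrow> real" where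
  "drift_mean_estimator t \<mu> n z = (\<Sum>k = 1..n. (z k - t * \<mu>)) / real n"

end

theory Submission imports Defs begin

text \<open>
  The sample mean of \<open>n\<close> independent normal variables with mean \<open>m\<close> and variance \<open>s\<^sup>2\<close> is again
  normal, with mean \<open>m\<close> and variance \<open>s\<^sup>2 / n\<close>, so its centred fourth moment is \<open>3 s\<^sup>4 / n\<^sup>2\<close>.
  These moments are summable, hence almost surely the fourth powers of the deviations of the
  sample means from \<open>m\<close> form a convergent series, and the deviations tend to \<open>0\<close>.
\<close>

lemma AE_tendsto_0_if_summable_integral:
  fixes f :: "nat \<Rightarrow> 'a \<Rightarrow> real"
  assumes int: "\<And>n. integrable M (f n)"
    and nonneg: "\<And>n x. 0 \<le> f n x"
    and sum: "summable (\<lambda>n. \<integral>x. f n x \<partial>M)"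
  shows "AE x in M. (\<lambda>n. f n x) \<longlonglongrightarrow> 0"
proof -
  have [measurable]: "f n \<in> borel_measurable M" for n
    using int by auto
  \<comment> \<open>Passing to \<open>ennreal\<close> allows sum and integral to be exchanged before
    any pointwise convergence is known. The integral of the sum is then finite, which forces the sum
    itself to be finite almost everywhere.\<close>
  have "(\<integral>\<^sup>+x. (\<Sum>n. ennreal (f n x)) \<partial>M) = (\<Sum>n. \<integral>\<^sup>+x. ennreal (f n x) \<partial>M)"
    by (rule nn_integral_suminf) measurable
  also have "\<dots> = (\<Sum>n. ennreal (\<integral>x. f n x \<partial>M))"
    by (simp add: nn_integral_eq_integral[OF int] nonneg)
  also have "\<dots> = ennreal (\<Sum>n. \<integral>x. f n x \<partial>M)"
    by (intro suminf_ennreal2 sum) (simp add: nonneg)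
  finally have "(\<integral>\<^sup>+x. (\<Sum>n. ennreal (f n x)) \<partial>M) \<noteq> \<infinity>"
    by simp
  then have "AE x in M. (\<Sum>n. ennreal (f n x)) \<noteq> \<infinity>"
    by (intro nn_integral_noteq_infinite) auto
  then show ?thesis
  proof eventually_elim
    case (elim x)
    then have "summable (\<lambda>n. f n x)"
      by (intro summable_suminf_not_top) (auto simp: nonneg)
    then show ?case
      by (rule summable_LIMSEQ_zero)
  qed
qed

lemma (in prob_space) normal_centered_fourth_moment:
  assumes s: "0 < s" and X: "distributed M lborel X (normal_density m s)"
  shows "integrable M (\<lambda>x. (X x - m) ^ 4)"
    and "expectation (\<lambda>x. (X x - m) ^ 4) = 3 * s ^ 4"
proof -
  have "integrable lborel (\<lambda>x. normal_density m s x * (x - m) ^ 4)"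
    using integrable_normal_moment[OF s] .
  then show "integrable M (\<lambda>x. (X x - m) ^ 4)"
    by (subst distributed_integrable[OF X, symmetric]) auto
  have "expectation (\<lambda>x. (X x - m) ^ 4) = (\<integral>x. normal_density m s x * (x - m) ^ 4 \<partial>lborel)"
    by (subst distributed_integral[OF X, symmetric]) auto
  also have "\<dots> = 3 * s ^ 4"
    \<comment> \<open>The even moment of order 2k is (2k)! s^(2k) / (2^k k!); for k = 2 the factor
      is 24 / 8 = 3.\<close>
    using integral_normal_moment_even[OF s, of m 2] s
    by (simp add: fact_numeral power_divide)
  finally show "expectation (\<lambda>x. (X x - m) ^ 4) = 3 * s ^ 4" .
qed

text \<open>Means and variances add up under independent normal summation, giving standard deviation
  \<open>sqrt n * s\<close>; scaling by \<open>1 / n\<close> leaves \<open>s / sqrt n\<close>. The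
  bound on \<open>n\<close> keeps the index set nonempty and the scaling factor nonzero.\<close>

lemma (in prob_space) normal_sample_mean:
  assumes n: "1 \<le> n" and s: "0 < s"
    and indep: "indep_vars (\<lambda>_. borel) X {1..n}"
    and normal: "\<And>k. k \<in> {1..n} \<Longrightarrow> distributed M lborel (X k) (normal_density m s)"
  shows "distributed M lborel (\<lambda>x. (\<Sum>k = 1..n. X k x) / real n)
           (normal_density m (s / sqrt (real n)))"
proof -
  have "distributed M lborel (\<lambda>x. \<Sum>k = 1..n. X k x)
      (normal_density (\<Sum>k = 1..n. m) (sqrt (\<Sum>k = 1..n. s\<^sup>2)))"
    using n s by (intro sum_indep_normal indep normal) auto
  then have "distributed M lborel (\<lambda>x. \<Sum>k = 1..n. X k x)
      (normal_density (real n * m) (sqrt (real n) * s))"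
    using s by (simp add: real_sqrt_mult)
  from normal_density_affine[OF this, of "1 / real n" 0]
  have "distributed M lborel (\<lambda>x. (\<Sum>k = 1..n. X k x) / real n)
      (normal_density m (\<bar>1 / real n\<bar> * (sqrt (real n) * s)))"
    using n s by simp
  moreover have "\<bar>1 / real n\<bar> * (sqrt (real n) * s) = s / sqrt (real n)"
    using n by (simp add: field_simps)
  ultimately show ?thesis
    by simp
qed

text \<open>The variances s^2 / n of the sample means are not summable, but their fourth moments are
  of order 1 / n^2. Using the latter gives convergence along the whole sequence, with no detour
  through subsequences.\<close>

theorem (in prob_space) strong_law_normal:
  assumes s: "0 < s"
    and indep: "indep_vars (\<lambda>_. borel) X {1..}"
    and normal: "\<And>k. 1 \<le> k \<Longrightarrow> distributed M lborel (X k) (normal_density m s)"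
  shows "AE x in M. (\<lambda>n. (\<Sum>k = 1..n. X k x) / real n) \<longlonglongrightarrow> m"
proof -
  \<comment> \<open>The shift to \<open>Suc n\<close> skips the empty mean at index 0, which is not
    normally distributed; \<open>LIMSEQ_imp_Suc\<close> undoes it at the end.\<close>
  define D where "D n x = (\<Sum>k = 1..Suc n. X k x) / real (Suc n) - m" for n x
  have mean: "distributed M lborel (\<lambda>x. (\<Sum>k = 1..Suc n. X k x) / real (Suc n))
      (normal_density m (s / sqrt (real (Suc n))))" for n
    using s normal by (intro normal_sample_mean indep_vars_subset[OF indep]) auto
  have pos: "0 < s / sqrt (real (Suc n))" for n
    using s by simp
  note moment = normal_centered_fourth_moment[OF pos mean, folded D_def]
  have "(sqrt (real (Suc n))) ^ 4 = (real (Suc n))\<^sup>2" for n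
    using power_mult[of "sqrt (real (Suc n))" 2 2] by simp
  then have "expectation (\<lambda>x. D n x ^ 4) = 3 * s ^ 4 * inverse ((real (Suc n))\<^sup>2)" for n
    unfolding moment(2) power_divide by (simp only: divide_inverse mult.assoc)
  moreover have "summable (\<lambda>n. inverse ((real (Suc n))\<^sup>2))"
    using inverse_power_summable[of 2, where 'a = real] by (subst summable_Suc_iff) simp
  ultimately have "summable (\<lambda>n. expectation (\<lambda>x. D n x ^ 4))"
    by (simp only: summable_mult)
  then have "AE x in M. (\<lambda>n. D n x ^ 4) \<longlonglongrightarrow> 0"
    by (intro AE_tendsto_0_if_summable_integral moment(1)) auto
  then show ?thesis
  proof eventually_elim
    case (elim x)
    then have "(\<lambda>n. D n x) \<longlonglongrightarrow> 0"
      by simp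
    then have "(\<lambda>n. D n x + m) \<longlonglongrightarrow> m"
      using tendsto_add[of "\<lambda>n. D n x" 0 sequentially "\<lambda>_. m" m] by simp
    then show ?case
      unfolding D_def diff_add_cancel by (rule LIMSEQ_imp_Suc)
  qed
qed

lemma prob_space_gaussian_measure: "0 < v \<Longrightarrow> prob_space (gaussian_measure m v)"
  unfolding gaussian_measure_def by (rule prob_space_normal_density) simp

lemma sets_gaussian_measure [simp]: "sets (gaussian_measure m v) = sets borel"
  by (simp add: gaussian_measure_def)

lemma AE_infinite_power_gaussian_mean:
  assumes v: "0 < v"
  shows "AE z in infinite_power (gaussian_measure m v).
           (\<lambda>n. (\<Sum>k = 1..n. z k) / real n) \<longlonglongrightarrow> m"
proof -
  let ?G = "gaussian_measure m v"
  let ?P = "infinite_power ?G"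
  have G: "prob_space ?G"
    by (rule prob_space_gaussian_measure[OF v])
  interpret P: prob_space ?P
    unfolding infinite_power_def by (intro prob_space_PiM G)
  have meas: "(\<lambda>z. z k) \<in> borel_measurable ?P" if "1 \<le> k" for k
    unfolding infinite_power_def
    by (subst measurable_cong_sets[OF refl sets_gaussian_measure[symmetric]],
        rule measurable_component_singleton) (use that in simp)
  have component: "distr ?P borel (\<lambda>z. z k) = ?G" if "1 \<le> k" for k
  proof -
    have "distr ?P borel (\<lambda>z. z k) = distr ?P ?G (\<lambda>z. z k)"
      by (rule distr_cong) auto
    also have "\<dots> = ?G"
      unfolding infinite_power_def using that by (intro distr_PiM_component G) auto
    finally show ?thesis .
  qed
  \<comment> \<open>Independence is proved by showing that the joint law of the coordinates is the
    product of their marginals. Points of \<open>?P\<close> are extensional, so the joint map is the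
    identity there and the joint law is \<open>?P\<close> itself.\<close>
  have "distr ?P (PiM {1..} (\<lambda>_. borel)) (\<lambda>z. \<lambda>k\<in>{1..}. z k)
      = distr ?P ?P (\<lambda>z. z)"
  proof (rule distr_cong)
    show "sets (PiM {1..} (\<lambda>_. borel)) = sets ?P"
      unfolding infinite_power_def by (rule sets_PiM_cong) simp_all
    show "(\<lambda>k\<in>{1..}. z k) = z" if "z \<in> space ?P" for z
      using that unfolding infinite_power_def space_PiM by (rule PiE_restrict)
  qed simp
  also have "\<dots> = PiM {1..} (\<lambda>k. distr ?P borel (\<lambda>z. z k))"
    unfolding distr_id by (subst infinite_power_def, rule PiM_cong) (simp_all add: component)
  finally have "P.indep_vars (\<lambda>_. borel) (\<lambda>k z. z k) {1..}"
    by (subst P.indep_vars_iff_distr_eq_PiM') (auto intro: meas)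
  moreover have "distributed ?P lborel (\<lambda>z. z k) (normal_density m (sqrt v))" if "1 \<le> k" for k
  proof -
    \<comment> \<open>A push-forward depends on its target only through the sigma-algebra, which
      \<open>lborel\<close> and \<open>borel\<close> share.\<close>
    have "distr ?P lborel (\<lambda>z. z k) = distr ?P borel (\<lambda>z. z k)"
      by (rule distr_cong) simp_all
    also have "\<dots> = density lborel (\<lambda>x. ennreal (normal_density m (sqrt v) x))"
      unfolding component[OF that] by (rule gaussian_measure_def)
    finally show ?thesis
      using meas[OF that] by (simp add: distributed_def)
  qed
  ultimately show ?thesis
    using v by (intro P.strong_law_normal[where s = "sqrt v"]) simp_all
qed

text \<open>For \<open>n = 0\<close> both quotients are 0 by convention, so the shift by
  \<open>\<mu> * t\<close> would be lost on the left.\<close>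

lemma drift_mean_estimator_eq:
  assumes "1 \<le> n"
  shows "drift_mean_estimator t \<mu> n (restrict z {1..n}) = (\<Sum>k = 1..n. z k) / real n - \<mu> * t"
  using assms by (simp add: drift_mean_estimator_def sum_subtractf field_simps)

lemma drift_mean_estimator_measurable:
  "drift_mean_estimator t \<mu> n \<in> borel_measurable (PiM {1..n} (\<lambda>_. borel))"
  unfolding drift_mean_estimator_def by measurable

theorem theorem3p3p1:
  fixes t \<mu> \<sigma> :: real
    and \<gamma> :: "real \<Rightarrow> real measure"
  assumes "t > 0" and "\<sigma> > 0"
    and "\<And>x0. \<gamma> x0 = gaussian_measure (x0 + \<mu> * t) (\<sigma>\<^sup>2 * t)"
  shows "(\<forall>x0. emeasure (infinite_power (\<gamma> x0))
            {z \<in> space (infinite_power (\<gamma> x0)).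
               (\<lambda>n. drift_mean_estimator t \<mu> n (restrict z {1..n})) \<longlonglongrightarrow> x0} = 1)
         \<and> consistent_estimator \<gamma> (drift_mean_estimator t \<mu>)"
proof -
  have v: "0 < \<sigma>\<^sup>2 * t"
    using assms by simp
  have G: "prob_space (\<gamma> x0)" for x0
    unfolding assms(3) by (rule prob_space_gaussian_measure[OF v])
  have sets: "sets (\<gamma> x0) = sets borel" for x0
    by (simp add: assms(3))
  have "emeasure (infinite_power (\<gamma> x0))
      {z \<in> space (infinite_power (\<gamma> x0)).
         (\<lambda>n. drift_mean_estimator t \<mu> n (restrict z {1..n})) \<longlonglongrightarrow> x0} = 1"
    (is "emeasure ?P ?A = 1") for x0
  proof -
    interpret P: prob_space ?P
      unfolding infinite_power_def by (intro prob_space_PiM G)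
    have "AE z in ?P. (\<lambda>n. (\<Sum>k = 1..n. z k) / real n) \<longlonglongrightarrow> x0 + \<mu> * t"
      unfolding assms(3) by (rule AE_infinite_power_gaussian_mean[OF v])
    then have "AE z in ?P. (\<lambda>n. drift_mean_estimator t \<mu> n (restrict z {1..n})) \<longlonglongrightarrow> x0"
    proof eventually_elim
      case (elim z)
      then have "(\<lambda>n. (\<Sum>k = 1..n. z k) / real n - \<mu> * t) \<longlonglongrightarrow> x0"
        using tendsto_diff[OF elim tendsto_const, of "\<mu> * t"] by simp
      then show ?case
        \<comment> \<open>The two sequences are only known to agree from index 1 on, which is enough
          for the limit.\<close>
        by (rule Lim_transform_eventually)
           (rule eventually_sequentiallyI[of 1], simp only: drift_mean_estimator_eq)
    qed
    \<comment> \<open>Almost sure convergence alone does not give measure 1: \<open>emeasure\<close>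
      is 0 on a non-measurable set.\<close>
    moreover have "?A \<in> sets ?P"
    proof -
      have [measurable]: "(\<lambda>z. drift_mean_estimator t \<mu> n (restrict z {1..n})) \<in> borel_measurable ?P" for n
        unfolding infinite_power_def
        \<comment> \<open>The estimator lives on n-dimensional space, so it is composed with the
          restriction map, whose measurability reduces to that of the coordinate
          projections.\<close>
        by (rule measurable_compose[OF _ drift_mean_estimator_measurable], rule measurable_restrict,
            subst measurable_cong_sets[OF refl sets[of x0, symmetric]], rule measurable_component_singleton)
           auto
      show ?thesis
        by measurable
    qed
    ultimately show ?thesis
      by (simp add: P.emeasure_eq_1_AE)
  qed
  then show ?thesis
    unfolding consistent_estimator_def
    using G sets drift_mean_estimator_measurable by blast
qed

end
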